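(* Let $n\geq 4$ and let $T$ be any $2$-eared triangulation of a convex $n$-gon $P$. Then the number of triangulations of $P$ disjoint from $T$ is $C_{n-3}$, where $C_k=\frac{1}{k+1}\binom{2k}{k}$ is the $k$th Catalan number.
   Context: A triangulation of a convex polygon $P$ uses non-crossing diagonals to divide $P$ into triangles. An ear of a triangulation is a triangle of it sharing two sides with $P$; a triangulation is $2$-eared if it has exactly two ears. Two triangulations of $P$ are disjoint if they have no diagonals in common. *)

theory Defs
  imports Main
begin

text \<open>Combinatorial model of a convex n-gon: vertices 0,...,n-1 in cyclic order.
Since the polygon is convex, crossing of diagonals is determined by the cyclic order.\<close>

definition side :: "nat \<Rightarrow> nat set \<Rightarrow> bool" where
  "side n e \<longleftrightarrow> (\<exists>i<n. e = {i, (i + 1) mod n})"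

definition diagonal :: "nat \<Rightarrow> nat set \<Rightarrow> bool" where
  "diagonal n e \<longleftrightarrow> (\<exists>i j. i < j \<and> j < n \<and> e = {i, j}) \<and> \<not> side n e"

definition crossing :: "nat set \<Rightarrow> nat set \<Rightarrow> bool" where
  "crossing e f \<longleftrightarrow> (\<exists>a b c d. (e = {a, b} \<and> f = {c, d} \<or> e = {c, d} \<and> f = {a, b})
                        \<and> a < c \<and> c < b \<and> b < d)"

definition noncrossing :: "nat \<Rightarrow> nat set set \<Rightarrow> bool" where
  "noncrossing n D \<longleftrightarrow> (\<forall>e\<in>D. diagonal n e) \<and> (\<forall>e\<in>D. \<forall>f\<in>D. \<not> crossing e f)"

text \<open>A triangulation: a maximal set of pairwise non-crossing diagonals
(equivalently, the diagonals divide P into triangles).\<close>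
definition triangulation :: "nat \<Rightarrow> nat set set \<Rightarrow> bool" where
  "triangulation n T \<longleftrightarrow> noncrossing n T \<and>
     (\<forall>e. diagonal n e \<and> e \<notin> T \<longrightarrow> \<not> noncrossing n (insert e T))"

definition triangles :: "nat \<Rightarrow> nat set set \<Rightarrow> nat set set" where
  "triangles n T = {t. \<exists>i j k. i < j \<and> j < k \<and> k < n \<and> t = {i, j, k} \<and>
      (\<forall>e\<in>{{i, j}, {j, k}, {i, k}}. side n e \<or> e \<in> T)}"

definition ears :: "nat \<Rightarrow> nat set set \<Rightarrow> nat set set" where
  "ears n T = {t \<in> triangles n T. 2 \<le> card {e. e \<subseteq> t \<and> card e = 2 \<and> side n e}}"

definition two_eared :: "nat \<Rightarrow> nat set set \<Rightarrow> bool" where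
  "two_eared n T \<longleftrightarrow> card (ears n T) = 2"

definition catalan :: "nat \<Rightarrow> nat" where
  "catalan k = ((2 * k) choose k) div (k + 1)"

end

theory Submission
  imports Defs "HOL-Computational_Algebra.Formal_Power_Series"
begin

text \<open>
  When \<open>T\<close> has only two ears, its diagonals are linearly ordered \<open>d\<^sub>0, d\<^sub>1, \<dots>\<close> from one ear to the other:
  each diagonal has one ear on either side, and the halves \<open>W\<^sub>i\<close> containing the first ear are nested
  with \<open>W\<^sub>i\<close> having \<open>i + 3\<close> vertices, since \<open>T\<close> has \<open>n - 3\<close> diagonals. Put \<open>m = n - 3\<close>. Sorting all
  triangulations of the \<open>n\<close>-gon by the first \<open>d\<^sub>i\<close> they contain, if any, gives
  \<open>C\<^sub>m\<^sub>+\<^sub>1 = g\<^sub>m + (\<Sum>i<m. g\<^sub>i * C\<^sub>m\<^sub>-\<^sub>i)\<close>, where \<open>g\<^sub>i\<close> counts the triangulations of \<open>W\<^sub>i\<close> that avoid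
  \<open>d\<^sub>0, \<dots>, d\<^sub>i\<^sub>-\<^sub>1\<close>. Comparison with Segner's recurrence yields \<open>g\<^sub>i = C\<^sub>i\<close> by induction.
\<close>

section \<open>Catalan numbers\<close>

fun segner :: "nat \<Rightarrow> nat" where
  "segner 0 = 1"
| "segner (Suc n) = (\<Sum>i\<le>n. segner i * segner (n - i))"

text \<open>Segner's convolution is a quadratic equation for the generating function. The square
  root of its discriminant satisfies a linear differential equation, whose coefficients give a
  recurrence with two terms. Integer coefficients make subtraction available.\<close>

lemma segner_ratio: "(n + 2) * segner (Suc n) = (4 * n + 2) * segner n"
proof -
  define C :: "int fps" where "C = Abs_fps (\<lambda>n. int (segner n))"
  define S where "S = 1 - 2 * fps_X * C"
  \<comment> \<open>\<open>S\<close> is the square root of \<open>1 - 4 X\<close>, so it satisfies \<open>(1 - 4 X) S' = - 2 S\<close>.\<close>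
  have C2: "fps_nth (C\<^sup>2) k = int (segner (Suc k))" for k
    by (simp add: C_def power2_eq_square fps_mult_nth atLeast0AtMost)
  have C: "C = 1 + fps_X * C\<^sup>2"
  proof (rule fps_ext)
    fix n show "fps_nth C n = fps_nth (1 + fps_X * C\<^sup>2) n"
      by (cases n) (simp_all add: C2 del: segner.simps(2), simp_all add: C_def)
  qed
  have "S\<^sup>2 = 1 - 4 * fps_X * (C - fps_X * C\<^sup>2)"
    by (simp add: S_def power2_eq_square algebra_simps)
  also have "C - fps_X * C\<^sup>2 = 1"
    using C by (simp add: algebra_simps)
  finally have S2: "S\<^sup>2 = 1 - 4 * fps_X" by simp
  have "fps_deriv (S\<^sup>2) = - 4"
    unfolding S2 by simp
  moreover have "fps_deriv (S\<^sup>2) = 2 * (S * fps_deriv S)"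
    by (simp add: power2_eq_square algebra_simps)
  ultimately have "2 * (S * fps_deriv S) = 2 * (- 2)" by simp
  then have SS': "S * fps_deriv S = - 2"
    by (metis mult_cancel_left zero_neq_numeral)
  have "(1 - 4 * fps_X) * fps_deriv S = S * (S * fps_deriv S)"
    unfolding S2[symmetric] by (simp add: power2_eq_square mult.assoc)
  then have ode: "(1 - 4 * fps_X) * fps_deriv S = - (2 * S)"
    unfolding SS' by (simp add: mult.commute)
  have S_nth: "fps_nth S (Suc k) = - 2 * int (segner k)" for k
    by (simp add: S_def C_def mult.assoc numeral_fps_const)
  \<comment> \<open>The coefficient at \<open>Suc n\<close> involves \<open>S\<close> at
    \<open>n + 2\<close> and \<open>n + 1\<close>, that is, \<open>segner (Suc n)\<close> and
    \<open>segner n\<close>.\<close>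
  have "fps_nth ((1 - 4 * fps_X) * fps_deriv S) (Suc n) = fps_nth (- (2 * S)) (Suc n)"
    by (simp only: ode)
  then have "(int n + 2) * int (segner (Suc n)) = (4 * int n + 2) * int (segner n)"
    by (simp add: left_diff_distrib mult.assoc numeral_fps_const S_nth del: segner.simps)
       (simp add: algebra_simps del: segner.simps)
  then show ?thesis
    by (simp add: algebra_simps flip: of_nat_eq_iff[where 'a=int] del: segner.simps)
qed

text \<open>Clearing the denominator turns the closed form into an identity that follows from
  \<open>segner_ratio\<close>. It also shows that the division in \<open>catalan\<close> is
  exact.\<close>

lemma Suc_times_segner: "Suc n * segner n = (2 * n) choose n"
proof (induction n)
  case (Suc n)
  \<comment> \<open>The extra factor \<open>Suc n\<close> makes room for the induction hypothesis
    and is cancelled at the end.\<close>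
  have "Suc n * (Suc (Suc n) * segner (Suc n)) = (4 * n + 2) * (Suc n * segner n)"
    using segner_ratio[of n] by (simp add: algebra_simps del: segner.simps)
  also have "\<dots> = 2 * (Suc (2 * n) * ((2 * n) choose n))"
    by (simp only: Suc.IH) (simp add: algebra_simps)
  also have "\<dots> = 2 * (Suc n * (Suc (2 * n) choose Suc n))"
    by (simp only: Suc_times_binomial_eq mult.commute)
  also have "\<dots> = Suc n * ((2 * Suc n) choose Suc n)"
  proof -
    have "Suc (2 * n) choose n = Suc (2 * n) choose Suc n"
      using binomial_symmetric[of n "Suc (2 * n)"] by simp
    then show ?thesis by (simp add: algebra_simps)
  qed
  finally show ?case by (metis mult_left_cancel old.nat.distinct(2))
qed simp

lemma catalan_eq_segner: "catalan n = segner n"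
  unfolding catalan_def by (simp flip: Suc_times_segner del: mult_Suc)

lemma catalan_Suc: "catalan (Suc n) = (\<Sum>i\<le>n. catalan i * catalan (n - i))"
  by (simp add: catalan_eq_segner)

section \<open>Maximal noncrossing families of chords\<close>

definition chords :: "nat set \<Rightarrow> nat set set" where
  "chords V = {{a, b} |a b. a \<in> V \<and> b \<in> V \<and> a < b}"

text \<open>Taken inside all chords of \<open>V\<close>, a maximal family also contains the sides of the polygon on \<open>V\<close>,
  since they cross nothing. The vertex set is arbitrary so that the two halves cut off by a chord are
  polygons of the same kind and need no relabelling.\<close>

definition maximal_noncrossing :: "nat set set \<Rightarrow> nat set set set" where
  "maximal_noncrossing P = {F. F \<subseteq> P \<and> (\<forall>e\<in>P. e \<in> F \<longleftrightarrow> (\<forall>f\<in>F. \<not> crossing e f))}"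

text \<open>Listing both pairs of endpoints in increasing order removes the existential choice of
  names in \<open>crossing\<close>, so that later crossing questions are pure order
  reasoning.\<close>

lemma crossing_iff:
  assumes "a < b" "c < d"
  shows "crossing {a, b} {c, d} \<longleftrightarrow> a < c \<and> c < b \<and> b < d \<or> c < a \<and> a < d \<and> d < b"
  using assms unfolding crossing_def doubleton_eq_iff by (auto dest: less_trans)

lemma crossing_commute: "crossing e f \<longleftrightarrow> crossing f e"
  unfolding crossing_def by blast

lemma not_crossing_self: "\<not> crossing e e"
  unfolding crossing_def by (auto simp: doubleton_eq_iff)

lemma doubleton_in_chords_iff: "a < b \<Longrightarrow> {a, b} \<in> chords V \<longleftrightarrow> a \<in> V \<and> b \<in> V"
  unfolding chords_def by (auto simp: doubleton_eq_iff)

lemma chordsE: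
  assumes "e \<in> chords V"
  obtains a b where "e = {a, b}" "a \<in> V" "b \<in> V" "a < b"
  using assms unfolding chords_def by blast

lemma chords_subset: "e \<in> chords V \<Longrightarrow> e \<subseteq> V"
  unfolding chords_def by auto

lemma chords_mono: "V \<subseteq> W \<Longrightarrow> chords V \<subseteq> chords W"
  unfolding chords_def by auto

lemma finite_chords: "finite V \<Longrightarrow> finite (chords V)"
  by (rule finite_subset[of _ "Pow V"]) (auto dest: chords_subset)

lemma finite_maximal_noncrossing: "finite P \<Longrightarrow> finite (maximal_noncrossing P)"
  by (rule finite_subset[of _ "Pow P"]) (auto simp: maximal_noncrossing_def)

lemma maximal_noncrossing_subset: "F \<in> maximal_noncrossing P \<Longrightarrow> F \<subseteq> P"
  unfolding maximal_noncrossing_def by blast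

lemma maximal_noncrossing_iff:
  "F \<in> maximal_noncrossing P \<Longrightarrow> e \<in> P \<Longrightarrow> e \<in> F \<longleftrightarrow> (\<forall>f\<in>F. \<not> crossing e f)"
  unfolding maximal_noncrossing_def by blast

lemma maximal_noncrossing_not_crossing:
  "F \<in> maximal_noncrossing P \<Longrightarrow> e \<in> F \<Longrightarrow> f \<in> F \<Longrightarrow> \<not> crossing e f"
  using maximal_noncrossing_iff maximal_noncrossing_subset by blast

text \<open>Once \<open>K\<close> is fixed, the remaining chords fall into classes that do not
  obstruct one another, so maximality can be tested in \<open>A\<close> and \<open>B\<close>
  separately, while \<open>Z\<close> is forced. The classes may overlap. One chord is cut with
  \<open>Z\<close> empty, a triangle with \<open>Z\<close> consisting of its base.\<close>

lemma maximal_noncrossing_split: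
  assumes ABZ: "A \<union> B \<union> Z = {p \<in> P. \<forall>k\<in>K. \<not> crossing p k}"
    and K: "K \<subseteq> A \<union> B \<union> Z"
    and nc: "\<And>p q. p \<in> A \<Longrightarrow> q \<in> B \<Longrightarrow> \<not> crossing p q"
    and Z: "\<And>p q. p \<in> Z \<Longrightarrow> q \<in> A \<union> B \<union> Z \<Longrightarrow> \<not> crossing p q"
  shows "bij_betw (\<lambda>F. (F \<inter> A, F \<inter> B)) {F \<in> maximal_noncrossing P. K \<subseteq> F}
           (maximal_noncrossing A \<times> maximal_noncrossing B)"
    and "\<And>F. F \<in> maximal_noncrossing P \<Longrightarrow> K \<subseteq> F \<Longrightarrow> F = F \<inter> A \<union> F \<inter> B \<union> Z"
proof -
  have nc': "\<not> crossing q p" if "p \<in> A" "q \<in> B" for p q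
    using nc[OF that] crossing_commute by blast
  have Z': "\<not> crossing q p" if "p \<in> Z" "q \<in> A \<union> B \<union> Z" for p q
    using Z[OF that] crossing_commute by blast
  have P: "A \<subseteq> P" "B \<subseteq> P" "Z \<subseteq> P" using ABZ by blast+
  have sub: "F \<subseteq> A \<union> B \<union> Z" if "F \<in> maximal_noncrossing P" "K \<subseteq> F" for F
    using that ABZ unfolding maximal_noncrossing_def by blast
  have ZF: "Z \<subseteq> F" if F: "F \<in> maximal_noncrossing P" "K \<subseteq> F" for F
    using sub[OF F] Z P maximal_noncrossing_iff[OF F(1)] by blast
  show decomp: "F = F \<inter> A \<union> F \<inter> B \<union> Z" if "F \<in> maximal_noncrossing P" "K \<subseteq> F" for F
    using sub[OF that] ZF[OF that] by blast
  have A: "F1 \<subseteq> A" "e \<in> A \<Longrightarrow> e \<in> F1 \<longleftrightarrow> (\<forall>f\<in>F1. \<not> crossing e f)" if "F1 \<in> maximal_noncrossing A" for F1 e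
    using that unfolding maximal_noncrossing_def by blast+
  have B: "F2 \<subseteq> B" "e \<in> B \<Longrightarrow> e \<in> F2 \<longleftrightarrow> (\<forall>f\<in>F2. \<not> crossing e f)" if "F2 \<in> maximal_noncrossing B" for F2 e
    using that unfolding maximal_noncrossing_def by blast+
  \<comment> \<open>A chord of \<open>A\<close> that enters through \<open>F2\<close> or
    \<open>Z\<close> crosses nothing in \<open>F1\<close>, hence belongs to \<open>F1\<close>
    already by maximality. The same holds for \<open>B\<close>, so overlaps do no harm.\<close>
  have restr: "(F1 \<union> F2 \<union> Z) \<inter> A = F1 \<and> (F1 \<union> F2 \<union> Z) \<inter> B = F2"
    if F1: "F1 \<in> maximal_noncrossing A" and F2: "F2 \<in> maximal_noncrossing B" for F1 F2
  proof -
    have "f \<in> F1" if "f \<in> F2 \<union> Z" "f \<in> A" for f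
      using A[OF F1] B[OF F2] nc' Z that by blast
    moreover have "f \<in> F2" if "f \<in> F1 \<union> Z" "f \<in> B" for f
      using A[OF F1] B[OF F2] nc Z that by blast
    ultimately show ?thesis using A(1)[OF F1] B(1)[OF F2] by blast
  qed
  have split: "F \<inter> A \<in> maximal_noncrossing A" "F \<inter> B \<in> maximal_noncrossing B"
    if F: "F \<in> maximal_noncrossing P" "K \<subseteq> F" for F
  proof -
    have "e \<in> F \<inter> A \<longleftrightarrow> (\<forall>f\<in>F \<inter> A. \<not> crossing e f)" if "e \<in> A" for e
      using maximal_noncrossing_iff[OF F(1), of e] sub[OF F] nc Z' that P by blast
    then show "F \<inter> A \<in> maximal_noncrossing A"
      unfolding maximal_noncrossing_def by blast
    have "e \<in> F \<inter> B \<longleftrightarrow> (\<forall>f\<in>F \<inter> B. \<not> crossing e f)" if "e \<in> B" for e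
      using maximal_noncrossing_iff[OF F(1), of e] sub[OF F] nc' Z' that P by blast
    then show "F \<inter> B \<in> maximal_noncrossing B"
      unfolding maximal_noncrossing_def by blast
  qed
  have join: "F1 \<union> F2 \<union> Z \<in> maximal_noncrossing P \<and> K \<subseteq> F1 \<union> F2 \<union> Z"
    if F1: "F1 \<in> maximal_noncrossing A" and F2: "F2 \<in> maximal_noncrossing B" for F1 F2
  proof -
    \<comment> \<open>By the choice of the classes, a member of \<open>K\<close> crosses nothing in
      \<open>A\<close> or \<open>B\<close>, so each maximal family on a class containing it must
      include it.\<close>
    have K12: "k \<in> F1 \<union> F2 \<union> Z" if "k \<in> K" for k
    proof -
      have "\<not> crossing k p" if "p \<in> A \<union> B" for p
        using that ABZ \<open>k \<in> K\<close> crossing_commute by blast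
      then show ?thesis using K \<open>k \<in> K\<close> A[OF F1] B[OF F2] by blast
    qed
    have "e \<in> F1 \<union> F2 \<union> Z \<longleftrightarrow> (\<forall>f\<in>F1 \<union> F2 \<union> Z. \<not> crossing e f)" if "e \<in> P" for e
    proof
      assume "e \<in> F1 \<union> F2 \<union> Z"
      then show "\<forall>f\<in>F1 \<union> F2 \<union> Z. \<not> crossing e f"
        using A[OF F1] B[OF F2] nc nc' Z Z' by blast
    next
      assume r: "\<forall>f\<in>F1 \<union> F2 \<union> Z. \<not> crossing e f"
      then have "e \<in> A \<union> B \<union> Z" using ABZ K12 \<open>e \<in> P\<close> by blast
      then show "e \<in> F1 \<union> F2 \<union> Z" using r A[OF F1] B[OF F2] by blast
    qed
    moreover have "F1 \<union> F2 \<union> Z \<subseteq> P" using A(1)[OF F1] B(1)[OF F2] P by blast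
    ultimately show ?thesis
      using K12 unfolding maximal_noncrossing_def by blast
  qed
  show "bij_betw (\<lambda>F. (F \<inter> A, F \<inter> B)) {F \<in> maximal_noncrossing P. K \<subseteq> F}
           (maximal_noncrossing A \<times> maximal_noncrossing B)"
  proof (rule bij_betw_byWitness[where f' = "\<lambda>(F1, F2). F1 \<union> F2 \<union> Z"])
    show "\<forall>F\<in>{F \<in> maximal_noncrossing P. K \<subseteq> F}.
        (case (F \<inter> A, F \<inter> B) of (F1, F2) \<Rightarrow> F1 \<union> F2 \<union> Z) = F"
      using decomp by auto
    show "\<forall>G\<in>maximal_noncrossing A \<times> maximal_noncrossing B.
        ((case G of (F1, F2) \<Rightarrow> F1 \<union> F2 \<union> Z) \<inter> A, (case G of (F1, F2) \<Rightarrow> F1 \<union> F2 \<union> Z) \<inter> B) = G"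
      using restr by auto
    show "(\<lambda>F. (F \<inter> A, F \<inter> B)) ` {F \<in> maximal_noncrossing P. K \<subseteq> F}
        \<subseteq> maximal_noncrossing A \<times> maximal_noncrossing B"
      using split by blast
    show "(\<lambda>(F1, F2). F1 \<union> F2 \<union> Z) ` (maximal_noncrossing A \<times> maximal_noncrossing B)
        \<subseteq> {F \<in> maximal_noncrossing P. K \<subseteq> F}"
      using join by clarsimp
  qed
qed

lemma maximal_noncrossing_singleton: "maximal_noncrossing {e} = {{e}}"
  unfolding maximal_noncrossing_def using not_crossing_self by auto

text \<open>The vertex sought is the farthest one in the interval that is joined to
  \<open>a\<close>. A chord blocking \<open>{v, b}\<close> can cross neither \<open>{a, b}\<close>
  nor \<open>{a, v}\<close>, so it starts at \<open>a\<close> and reaches beyond \<open>v\<close>,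
  against the choice of \<open>v\<close>.\<close>

lemma apex_exists:
  assumes V: "finite V" and F: "F \<in> maximal_noncrossing (chords V)"
    and ab: "{a, b} \<in> F" "a < b" and ne: "V \<inter> {a<..<b} \<noteq> {}"
  obtains v where "v \<in> V" "a < v" "v < b" "{a, v} \<in> F" "{v, b} \<in> F"
proof -
  have abV: "a \<in> V" "b \<in> V"
    using ab maximal_noncrossing_subset[OF F] doubleton_in_chords_iff by blast+
  have cross: "\<exists>c d. c < d \<and> c \<in> V \<and> d \<in> V \<and> {c, d} \<in> F \<and> (x < c \<and> c < y \<and> y < d \<or> c < x \<and> x < d \<and> d < y)"
    if "{x, y} \<notin> F" "x \<in> V" "y \<in> V" "x < y" for x y
  proof -
    obtain f where "f \<in> F" "crossing {x, y} f"
      using maximal_noncrossing_iff[OF F, of "{x, y}"] \<open>{x, y} \<notin> F\<close> \<open>x \<in> V\<close> \<open>y \<in> V\<close> \<open>x < y\<close>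
      by (auto simp: doubleton_in_chords_iff)
    moreover from \<open>f \<in> F\<close> obtain c d where "f = {c, d}" "c \<in> V" "d \<in> V" "c < d"
      using maximal_noncrossing_subset[OF F] chordsE by blast
    ultimately show ?thesis using crossing_iff that by blast
  qed
  have nc: "\<not> (p < r \<and> r < q \<and> q < s)" if "{p, q} \<in> F" "{r, s} \<in> F" "p < q" "r < s" for p q r s
    using maximal_noncrossing_not_crossing[OF F that(1,2)] crossing_iff that by blast
  \<comment> \<open>\<open>u\<close> is the vertex right after \<open>a\<close>. A chord crossing
    \<open>{a, u}\<close> would need a vertex between the two, so \<open>{a, u}\<close> is in
    \<open>F\<close>, and the set \<open>M\<close> below is nonempty.\<close>
  define u where "u = Min (V \<inter> {a<..<b})"
  have u: "u \<in> V" "a < u" "u < b" and u_le: "\<And>x. x \<in> V \<Longrightarrow> a < x \<Longrightarrow> x < b \<Longrightarrow> u \<le> x"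
    using Min_in[of "V \<inter> {a<..<b}"] Min_le[of "V \<inter> {a<..<b}"] V ne unfolding u_def by auto
  have "{a, u} \<in> F"
  proof (rule ccontr)
    assume "{a, u} \<notin> F"
    from cross[OF this abV(1) u(1,2)] show False
      using u_le u by (meson leD less_trans)
  qed
  define M where "M = {v \<in> V. a < v \<and> v < b \<and> {a, v} \<in> F}"
  define v where "v = Max M"
  have "finite M" "M \<noteq> {}" using V u \<open>{a, u} \<in> F\<close> unfolding M_def by auto
  then have "v \<in> M" and v_ge: "\<And>x. x \<in> M \<Longrightarrow> x \<le> v"
    unfolding v_def by auto
  then have v: "v \<in> V" "a < v" "v < b" "{a, v} \<in> F" unfolding M_def by auto
  have "{v, b} \<in> F"
  proof (rule ccontr)
    assume "{v, b} \<notin> F"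
    from cross[OF this v(1) abV(2) v(3)] obtain c d where
      cd: "c < d" "c \<in> V" "d \<in> V" "{c, d} \<in> F" "v < c \<and> c < b \<and> b < d \<or> c < v \<and> v < d \<and> d < b"
      by blast
    have "\<not> (a < c \<and> c < b \<and> b < d)" "\<not> (c < a \<and> a < d \<and> d < b)" "\<not> (a < c \<and> c < v \<and> v < d)"
      using nc cd ab v by blast+
    then have "c = a" "v < d" "d < b" using cd v by linarith+
    then show False using v_ge[of d] cd v unfolding M_def by auto
  qed
  with v that show thesis by blast
qed

section \<open>Cutting along chords\<close>

text \<open>Both halves keep the endpoints of the chord. Either half may come first, so that
  \<open>W\<close> can later be the one containing a chosen ear.\<close>

definition halves :: "nat set \<Rightarrow> nat set \<Rightarrow> nat set \<Rightarrow> nat set \<Rightarrow> bool" where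
  "halves V e W W' \<longleftrightarrow> (\<exists>a b. a < b \<and> a \<in> V \<and> b \<in> V \<and> e = {a, b} \<and>
     (W = V \<inter> {a..b} \<and> W' = V - {a<..<b} \<or> W = V - {a<..<b} \<and> W' = V \<inter> {a..b}))"

lemma halves_commute: "halves V e W W' \<longleftrightarrow> halves V e W' W"
  unfolding halves_def by blast

lemma halves_Un: "halves V e W W' \<Longrightarrow> W \<union> W' = V"
  unfolding halves_def by auto

lemma halves_Int: "halves V e W W' \<Longrightarrow> W \<inter> W' = e"
  unfolding halves_def by auto

lemma card_halves:
  assumes "halves V e W W'" "finite V"
  shows "card W + card W' = card V + 2"
proof -
  have "card e = 2" using assms(1) unfolding halves_def by auto
  moreover have "finite W" "finite W'"
    using assms halves_Un[OF assms(1)] by auto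
  ultimately show ?thesis
    using card_Un_Int[of W W'] halves_Un[OF assms(1)] halves_Int[OF assms(1)] by simp
qed

text \<open>The half \<open>W\<close> contains both ends of \<open>e\<close>, so \<open>e\<close> is
  still a chord of the smaller polygon \<open>U\<close>. This lets an induction over nested halves
  pass from \<open>V\<close> to one of them.\<close>

lemma halves_restrict:
  assumes "halves V e W W'" "W \<subseteq> U" "U \<subseteq> V"
  shows "halves U e W (U \<inter> W')"
proof -
  obtain a b where ab: "a < b" "a \<in> V" "b \<in> V" "e = {a, b}"
    and W: "W = V \<inter> {a..b} \<and> W' = V - {a<..<b} \<or> W = V - {a<..<b} \<and> W' = V \<inter> {a..b}"
    using assms unfolding halves_def by blast
  have "a \<in> W" "b \<in> W" using ab W by auto
  then have "a \<in> U" "b \<in> U" using assms(2) by blast+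
  moreover have "W = U \<inter> {a..b} \<and> U \<inter> W' = U - {a<..<b} \<or> W = U - {a<..<b} \<and> U \<inter> W' = U \<inter> {a..b}"
    using W
  proof (elim disjE conjE)
    assume "W = V \<inter> {a..b}" "W' = V - {a<..<b}"
    then show ?thesis using assms(2,3) by blast
  next
    assume "W = V - {a<..<b}" "W' = V \<inter> {a..b}"
    then show ?thesis using assms(2,3) by blast
  qed
  ultimately show ?thesis using ab(1,4) unfolding halves_def by blast
qed

text \<open>These are the hypotheses of \<open>maximal_noncrossing_split\<close> for
  \<open>K = {e}\<close> and empty \<open>Z\<close>: a chord crosses \<open>e\<close> exactly when
  its ends lie strictly on opposite sides.\<close>

lemma chords_halves:
  assumes "halves V e W W'"
  shows "chords W \<union> chords W' = {p \<in> chords V. \<not> crossing p e}"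
    and "\<And>p q. p \<in> chords W \<Longrightarrow> q \<in> chords W' \<Longrightarrow> \<not> crossing p q"
    and "e \<in> chords W" "e \<in> chords W'"
proof -
  obtain a b where ab: "a < b" "a \<in> V" "b \<in> V" "e = {a, b}"
    and W: "W = V \<inter> {a..b} \<and> W' = V - {a<..<b} \<or> W = V - {a<..<b} \<and> W' = V \<inter> {a..b}"
    using assms unfolding halves_def by blast
  have "p \<in> chords W \<union> chords W' \<longleftrightarrow> p \<in> chords V \<and> \<not> crossing p e" for p
  proof (cases "p \<in> chords V")
    case True
    then obtain c d where "p = {c, d}" "c \<in> V" "d \<in> V" "c < d" by (rule chordsE)
    then show ?thesis
      using ab W by (auto simp: doubleton_in_chords_iff crossing_iff)
  next
    case False
    then show ?thesis using chords_mono[of W V] chords_mono[of W' V] W by auto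
  qed
  then show "chords W \<union> chords W' = {p \<in> chords V. \<not> crossing p e}" by blast
  show "\<not> crossing p q" if "p \<in> chords W" "q \<in> chords W'" for p q
    using that ab W by (elim chordsE) (auto simp: crossing_iff)
  show "e \<in> chords W" "e \<in> chords W'"
    using ab W by (auto simp: doubleton_in_chords_iff)
qed

lemma bij_betw_halves:
  assumes "halves V e W W'"
  shows "bij_betw (\<lambda>F. (F \<inter> chords W, F \<inter> chords W')) {F \<in> maximal_noncrossing (chords V). e \<in> F}
           (maximal_noncrossing (chords W) \<times> maximal_noncrossing (chords W'))"
proof -
  note h = chords_halves[OF assms]
  have "bij_betw (\<lambda>F. (F \<inter> chords W, F \<inter> chords W')) {F \<in> maximal_noncrossing (chords V). {e} \<subseteq> F}
           (maximal_noncrossing (chords W) \<times> maximal_noncrossing (chords W'))"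
  proof (rule maximal_noncrossing_split(1)[where Z = "{}"])
    show "chords W \<union> chords W' \<union> {} = {p \<in> chords V. \<forall>k\<in>{e}. \<not> crossing p k}"
      using h(1) by simp
  qed (use h(2,3) in simp_all)
  then show ?thesis by simp
qed

text \<open>Fixing the triangle with base \<open>{a, b}\<close> and apex \<open>v\<close> leaves the
  chords on either side of \<open>v\<close> and the base itself. The base lies in neither piece and
  crosses nothing, so it takes the place of \<open>Z\<close>.\<close>

lemma apex_split:
  assumes "finite V" "v \<in> V" "Min V < v" "v < Max V"
  defines "a \<equiv> Min V" and "b \<equiv> Max V"
  shows "bij_betw (\<lambda>F. (F \<inter> chords (V \<inter> {a..v}), F \<inter> chords (V \<inter> {v..b})))
           {F \<in> maximal_noncrossing (chords V). {a, v} \<in> F \<and> {v, b} \<in> F}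
           (maximal_noncrossing (chords (V \<inter> {a..v})) \<times> maximal_noncrossing (chords (V \<inter> {v..b})))"
    and "\<And>F. F \<in> maximal_noncrossing (chords V) \<Longrightarrow> {a, v} \<in> F \<Longrightarrow> {v, b} \<in> F \<Longrightarrow>
      F = F \<inter> chords (V \<inter> {a..v}) \<union> F \<inter> chords (V \<inter> {v..b}) \<union> {{a, b}}"
proof -
  have V: "a \<in> V" "b \<in> V"
    using assms Min_in[of V] Max_in[of V] by blast+
  have V': "a \<le> x \<and> x \<le> b" if "x \<in> V" for x
    using assms that by simp
  have v: "a < v" "v < b"
    using assms by simp_all
  let ?A = "chords (V \<inter> {a..v})" and ?B = "chords (V \<inter> {v..b})" and ?K = "{{a, v}, {v, b}}"
  have "p \<in> ?A \<union> ?B \<union> {{a, b}} \<longleftrightarrow> p \<in> chords V \<and> (\<forall>k\<in>?K. \<not> crossing p k)" for p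
  proof (cases "p \<in> chords V")
    case True
    then obtain c d where p: "p = {c, d}" "c \<in> V" "d \<in> V" "c < d" by (rule chordsE)
    then have "a \<le> c" "d \<le> b" using V' by auto
    then show ?thesis
      using p V v \<open>v \<in> V\<close>
      by (auto simp: doubleton_in_chords_iff crossing_iff doubleton_eq_iff)
  next
    case False
    then show ?thesis
      using chords_mono[of "V \<inter> {a..v}" V] chords_mono[of "V \<inter> {v..b}" V] V v
        doubleton_in_chords_iff[of a b V] by auto
  qed
  then have 1: "?A \<union> ?B \<union> {{a, b}} = {p \<in> chords V. \<forall>k\<in>?K. \<not> crossing p k}" by blast
  have 2: "?K \<subseteq> ?A \<union> ?B \<union> {{a, b}}"
    using V v \<open>v \<in> V\<close> by (auto simp: doubleton_in_chords_iff)
  have 3: "\<not> crossing p q" if "p \<in> ?A" "q \<in> ?B" for p q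
    using that by (elim chordsE) (auto simp: crossing_iff)
  have 4: "\<not> crossing p q" if "p \<in> {{a, b}}" "q \<in> ?A \<union> ?B \<union> {{a, b}}" for p q
  proof -
    have "q \<in> chords V" using that(2) 1 by blast
    then obtain c d where "q = {c, d}" "c \<in> V" "d \<in> V" "c < d" by (rule chordsE)
    then show ?thesis using that(1) V'[of c] V'[of d] v by (auto simp: crossing_iff)
  qed
  note split = maximal_noncrossing_split[OF 1 2 3 4]
  show "bij_betw (\<lambda>F. (F \<inter> ?A, F \<inter> ?B))
           {F \<in> maximal_noncrossing (chords V). {a, v} \<in> F \<and> {v, b} \<in> F}
           (maximal_noncrossing ?A \<times> maximal_noncrossing ?B)"
    using split(1) by simp
  show "F = F \<inter> ?A \<union> F \<inter> ?B \<union> {{a, b}}"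
    if "F \<in> maximal_noncrossing (chords V)" "{a, v} \<in> F" "{v, b} \<in> F" for F
    using split(2)[of F] that by simp
qed

section \<open>Counting maximal families by the triangle on the base\<close>

lemma base_in_maximal_noncrossing:
  assumes "finite V" "V \<noteq> {}" "Min V < Max V" "F \<in> maximal_noncrossing (chords V)"
  shows "{Min V, Max V} \<in> F"
proof -
  have "\<not> crossing {Min V, Max V} f" if "f \<in> F" for f
  proof -
    from that obtain c d where f: "f = {c, d}" "c \<in> V" "d \<in> V" "c < d"
      using maximal_noncrossing_subset[OF assms(4)] chordsE by blast
    have "Min V \<le> c" "d \<le> Max V" using f assms(1) by simp_all
    then show ?thesis unfolding f(1) crossing_iff[OF assms(3) f(4)] by linarith
  qed
  then show ?thesis
    using maximal_noncrossing_iff[OF assms(4), of "{Min V, Max V}"] assms(1,2,3)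
    by (simp add: doubleton_in_chords_iff)
qed

lemma base_apex_exists:
  assumes "finite V" "3 \<le> card V" "F \<in> maximal_noncrossing (chords V)"
  obtains v where "v \<in> V" "Min V < v" "v < Max V" "{Min V, v} \<in> F" "{v, Max V} \<in> F"
proof -
  have ne: "V \<noteq> {}" using assms(2) by auto
  have "card {Min V, Max V} \<le> 2" by (simp add: card_insert_if)
  then have "\<not> V \<subseteq> {Min V, Max V}" using assms(2) card_mono[of "{Min V, Max V}" V] by auto
  then obtain x where x: "x \<in> V" "x \<noteq> Min V" "x \<noteq> Max V" by blast
  then have "Min V < x" "x < Max V"
    using assms(1) Min_le[of V x] Max_ge[of V x] by linarith+
  then show thesis
    using apex_exists[OF assms(1,3) base_in_maximal_noncrossing[OF assms(1) ne _ assms(3)]] x that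
    by (metis Int_iff emptyE greaterThanLessThan_iff less_trans)
qed

lemma maximal_noncrossing_card_2:
  assumes "card V = 2"
  obtains e where "chords V = {e}" "maximal_noncrossing (chords V) = {{e}}"
proof -
  obtain x y where "V = {x, y}" "x < y"
    using assms by (metis card_2_iff insert_commute linorder_neqE_nat)
  then have "chords V = {{x, y}}"
    unfolding chords_def by auto
  then show thesis using that maximal_noncrossing_singleton by metis
qed

lemma card_apex_pieces:
  fixes V :: "nat set"
  assumes "finite V" "v \<in> V" "Min V < v" "v < Max V"
  shows "card (V \<inter> {Min V..v}) + card (V \<inter> {v..Max V}) = card V + 1"
    and "2 \<le> card (V \<inter> {Min V..v})" "2 \<le> card (V \<inter> {v..Max V})"
proof -
  have 1: "V \<inter> {Min V..v} \<union> V \<inter> {v..Max V} = V" "V \<inter> {Min V..v} \<inter> (V \<inter> {v..Max V}) = {v}"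
    using assms by auto
  show "card (V \<inter> {Min V..v}) + card (V \<inter> {v..Max V}) = card V + 1"
    using card_Un_Int[of "V \<inter> {Min V..v}" "V \<inter> {v..Max V}"] assms(1) unfolding 1 by simp
  have "Min V \<in> V" "Max V \<in> V" using assms Min_in[of V] Max_in[of V] by blast+
  then have "{Min V, v} \<subseteq> V \<inter> {Min V..v}" "{v, Max V} \<subseteq> V \<inter> {v..Max V}"
    using assms by auto
  from this[THEN card_mono[rotated]] show "2 \<le> card (V \<inter> {Min V..v})" "2 \<le> card (V \<inter> {v..Max V})"
    using assms by auto
qed

text \<open>Removing the base and splitting at its apex leaves two families on pieces with one
  common vertex; for \<open>N\<close> vertices this adds up to \<open>(2 * N + 2) - 6 + 1\<close>.
  The additive form avoids truncated subtraction.\<close>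

lemma card_in_maximal_noncrossing:
  assumes "finite V" "2 \<le> card V" "F \<in> maximal_noncrossing (chords V)"
  shows "card F + 3 = 2 * card V"
  using assms
proof (induction "card V" arbitrary: V F rule: less_induct)
  case less
  show ?case
  proof (cases "card V = 2")
    case True
    then obtain e where "maximal_noncrossing (chords V) = {{e}}"
      by (rule maximal_noncrossing_card_2)
    then show ?thesis using less.prems True by auto
  next
    case False
    then have "3 \<le> card V" using less.prems by simp
    then obtain v where v: "v \<in> V" "Min V < v" "v < Max V" "{Min V, v} \<in> F" "{v, Max V} \<in> F"
      using base_apex_exists less.prems by metis
    define X Y where "X = V \<inter> {Min V..v}" and "Y = V \<inter> {v..Max V}"
    note cards = card_apex_pieces[OF less.prems(1) v(1-3), folded X_def Y_def]
    note split = apex_split[OF less.prems(1) v(1-3), folded X_def Y_def]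
    have fin: "finite X" "finite Y" using less.prems(1) unfolding X_def Y_def by auto
    have mem: "F \<inter> chords X \<in> maximal_noncrossing (chords X)"
        "F \<inter> chords Y \<in> maximal_noncrossing (chords Y)"
      using bij_betwE[OF split(1)] less.prems(3) v(4,5) by auto
    have IH: "card (F \<inter> chords X) + 3 = 2 * card X" "card (F \<inter> chords Y) + 3 = 2 * card Y"
      using less.hyps[of X] less.hyps[of Y] cards fin mem by auto
    have "chords X \<inter> chords Y = {}" "{Min V, Max V} \<notin> chords X" "{Min V, Max V} \<notin> chords Y"
      using v unfolding X_def Y_def
      by (auto elim!: chordsE simp: doubleton_eq_iff)
    moreover have "finite (F \<inter> chords X)" "finite (F \<inter> chords Y)"
      using finite_chords fin by auto
    ultimately have "card (F \<inter> chords X \<union> F \<inter> chords Y \<union> {{Min V, Max V}})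
        = card (F \<inter> chords X) + card (F \<inter> chords Y) + 1"
      by (subst card_Un_disjoint; (subst card_Un_disjoint)?; auto)
    then show ?thesis using split(2)[OF less.prems(3) v(4,5)] IH cards by simp
  qed
qed

lemma strictly_between_Min_Max:
  fixes V :: "nat set"
  assumes "finite V" "v \<in> V - {Min V, Max V}"
  shows "Min V < v" "v < Max V"
  using assms le_neq_implies_less[OF Min_le[of V v]] le_neq_implies_less[OF Max_ge[of V v]] by auto

text \<open>This reindexes a sum over the possible apices as the sum over \<open>i \<le> m\<close>
  in Segner's recurrence. The rank is injective because it increases strictly with \<open>v\<close>,
  and surjective by counting.\<close>

lemma bij_betw_rank:
  fixes V :: "nat set"
  assumes "finite V" "card V = m + 3"
  shows "bij_betw (\<lambda>v. card (V \<inter> {Min V<..<v})) (V - {Min V, Max V}) {..m}"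
proof -
  let ?r = "\<lambda>v. card (V \<inter> {Min V<..<v})"
  let ?U = "V - {Min V, Max V}"
  have ne: "V \<noteq> {}" using assms by auto
  have in_V: "Min V \<in> V" "Max V \<in> V" using assms ne by auto
  have "Min V \<noteq> Max V"
  proof
    assume "Min V = Max V"
    then have "V \<subseteq> {Min V}" using assms(1) Min_le Max_ge by (metis antisym singletonI subsetI)
    then show False using assms card_mono[of "{Min V}" V] by simp
  qed
  then have card_U: "card ?U = m + 1" using in_V assms by (simp add: card_Diff_subset)
  have bounds: "Min V < v" "v < Max V" if "v \<in> ?U" for v
    using strictly_between_Min_Max[OF assms(1) that] .
  have less: "?r v < ?r w" if "v \<in> ?U" "w \<in> ?U" "v < w" for v w
    by (rule psubset_card_mono) (use that bounds assms in auto)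
  have inj: "inj_on ?r ?U"
    by (rule inj_onI) (metis less linorder_neqE_nat less_irrefl)
  have "?r v \<le> m" if "v \<in> ?U" for v
  proof -
    have "V \<inter> {Min V<..<v} \<subseteq> ?U - {v}" using bounds(2)[OF that] by auto
    then have "?r v \<le> card (?U - {v})" using assms by (intro card_mono) auto
    then show ?thesis using card_U that by simp
  qed
  then have "?r ` ?U \<subseteq> {..m}" by auto
  then have "?r ` ?U = {..m}"
    by (rule card_subset_eq[rotated]) (use card_image[OF inj] card_U in auto)
  with inj show ?thesis unfolding bij_betw_def by blast
qed

text \<open>Segner's argument: every family has exactly one apex over its base, and the pieces on
  the two sides of the apex can be filled independently.\<close>

lemma card_maximal_noncrossing:
  assumes "finite V" "card V = m + 2"
  shows "card (maximal_noncrossing (chords V)) = catalan m"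
  using assms
proof (induction m arbitrary: V rule: less_induct)
  case (less m)
  show ?case
  proof (cases m)
    case 0
    then have "card V = 2" using less.prems by simp
    then obtain e where "maximal_noncrossing (chords V) = {{e}}"
      by (rule maximal_noncrossing_card_2)
    then show ?thesis using 0 by (simp add: catalan_def)
  next
    case (Suc k)
    let ?U = "V - {Min V, Max V}"
    let ?r = "\<lambda>v. card (V \<inter> {Min V<..<v})"
    define G where "G v = {F \<in> maximal_noncrossing (chords V). {Min V, v} \<in> F \<and> {v, Max V} \<in> F}" for v
    have cV: "card V = k + 3" using less.prems Suc by simp
    have bounds: "Min V < v" "v < Max V" if "v \<in> ?U" for v
      using strictly_between_Min_Max[OF less.prems(1) that] .
    have "maximal_noncrossing (chords V) = (\<Union>v\<in>?U. G v)"
    proof (intro equalityI subsetI)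
      fix F assume F: "F \<in> maximal_noncrossing (chords V)"
      obtain v where "v \<in> V" "Min V < v" "v < Max V" "{Min V, v} \<in> F" "{v, Max V} \<in> F"
        by (rule base_apex_exists[OF less.prems(1) _ F]) (use cV in auto)
      then show "F \<in> (\<Union>v\<in>?U. G v)" using F unfolding G_def by auto
    qed (auto simp: G_def)
    also have "card \<dots> = (\<Sum>v\<in>?U. card (G v))"
    proof (rule card_UN_disjoint)
      show "\<forall>v\<in>?U. finite (G v)"
        using finite_maximal_noncrossing[OF finite_chords[OF less.prems(1)]] unfolding G_def by simp
      \<comment> \<open>The apex is unique: with apices \<open>v < w\<close>, the edge from the
        minimum to \<open>w\<close> would cross the edge from \<open>v\<close> to the
        maximum.\<close>
      have "G v \<inter> G w = {}" if "v \<in> ?U" "w \<in> ?U" "v < w" for v w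
      proof -
        have "crossing {Min V, w} {v, Max V}"
          using that bounds[of v] bounds[of w] by (simp add: crossing_iff)
        then show ?thesis unfolding G_def using maximal_noncrossing_not_crossing by blast
      qed
      then show "\<forall>v\<in>?U. \<forall>w\<in>?U. v \<noteq> w \<longrightarrow> G v \<inter> G w = {}"
        by (metis Int_commute linorder_neqE_nat)
    qed (use less.prems in simp)
    also have "\<dots> = (\<Sum>v\<in>?U. catalan (?r v) * catalan (k - ?r v))"
    proof (rule sum.cong[OF refl])
      fix v assume v: "v \<in> ?U"
      then have v': "v \<in> V" "Min V < v" "v < Max V" using bounds by auto
      define X Y where "X = V \<inter> {Min V..v}" and "Y = V \<inter> {v..Max V}"
      note cards = card_apex_pieces[OF less.prems(1) v', folded X_def Y_def]
      have fin: "finite X" "finite Y" using less.prems(1) unfolding X_def Y_def by auto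
      have "Min V \<in> V" using v'(1) Min_in[of V] less.prems(1) by blast
      then have "X = insert (Min V) (insert v (V \<inter> {Min V<..<v}))"
        using v' less.prems(1) le_neq_implies_less[OF Min_le[of V]] unfolding X_def by auto
      then have cX: "card X = ?r v + 2" using v' less.prems(1) by simp
      then have cY: "card Y = k - ?r v + 2" "?r v \<le> k" using cards cV by auto
      have "card (G v) = card (maximal_noncrossing (chords X) \<times> maximal_noncrossing (chords Y))"
        using bij_betw_same_card[OF apex_split(1)[OF less.prems(1) v']] unfolding G_def X_def Y_def .
      also have "\<dots> = catalan (?r v) * catalan (k - ?r v)"
        using less.IH[OF _ fin(1) cX] less.IH[OF _ fin(2) cY(1)] cY(2) Suc
        by (simp add: card_cartesian_product)
      finally show "card (G v) = catalan (?r v) * catalan (k - ?r v)" .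
    qed
    also have "\<dots> = (\<Sum>i\<le>k. catalan i * catalan (k - i))"
      using sum.reindex_bij_betw[OF bij_betw_rank[OF less.prems(1) cV],
        where g = "\<lambda>i. catalan i * catalan (k - i)"] .
    finally show ?thesis using Suc catalan_Suc by simp
  qed
qed

section \<open>Families avoiding a chain of chords\<close>

lemma halves_nested:
  assumes "halves V d W W'" "halves V e U U'" "\<not> crossing d e"
  shows "W \<subseteq> U \<or> U \<subseteq> W \<or> W \<subseteq> U' \<or> U' \<subseteq> W"
proof -
  obtain a b where ab: "a < b" "d = {a, b}"
    and W: "W = V \<inter> {a..b} \<or> W = V - {a<..<b}"
    using assms(1) unfolding halves_def by blast
  obtain c f where cf: "c < f" "e = {c, f}"
    and U: "U = V \<inter> {c..f} \<and> U' = V - {c<..<f} \<or> U = V - {c<..<f} \<and> U' = V \<inter> {c..f}"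
    using assms(2) unfolding halves_def by blast
  have "\<not> (a < c \<and> c < b \<and> b < f)" "\<not> (c < a \<and> a < f \<and> f < b)"
    using assms(3) ab cf by (auto simp: crossing_iff)
  \<comment> \<open>Without a crossing, the intervals spanned by the two chords are nested or share
    at most an endpoint. Each case gives one of the inclusions, whichever side of its chord each
    half is.\<close>
  then consider "b \<le> c" | "f \<le> a" | "a \<le> c" "f \<le> b" | "c \<le> a" "b \<le> f" using ab(1) cf(1) by linarith
  then show ?thesis
  proof cases
    case 1
    then have "{a..b} \<inter> {c<..<f} = {}" "{a<..<b} \<inter> {c..f} = {}" by auto
    then show ?thesis using W U by blast
  next
    case 2
    then have "{a..b} \<inter> {c<..<f} = {}" "{a<..<b} \<inter> {c..f} = {}" by auto
    then show ?thesis using W U by blast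
  next
    case 3
    then have "{c..f} \<subseteq> {a..b}" "{c<..<f} \<subseteq> {a<..<b}" by auto
    then show ?thesis using W U by blast
  next
    case 4
    then have "{a..b} \<subseteq> {c..f}" "{a<..<b} \<subseteq> {c<..<f}" by auto
    then show ?thesis using W U by blast
  qed
qed

text \<open>\<open>W m\<close> is the whole polygon and carries no chord \<open>d m\<close>. The
  polygon \<open>W i\<close> has the chain \<open>d 0\<close>, ..., \<open>d (i - 1)\<close> of its
  own, so the statement applies to it by induction.\<close>

lemma card_avoiding_chain:
  fixes W :: "nat \<Rightarrow> nat set" and d :: "nat \<Rightarrow> nat set"
  assumes "finite (W m)"
    and "\<And>i. i \<le> m \<Longrightarrow> card (W i) = i + 3"
    and "\<And>i j. i \<le> j \<Longrightarrow> j \<le> m \<Longrightarrow> W i \<subseteq> W j"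
    and "\<And>i. i < m \<Longrightarrow> \<exists>W'. halves (W m) (d i) (W i) W'"
  shows "card {F \<in> maximal_noncrossing (chords (W m)). \<forall>i<m. d i \<notin> F} = catalan m"
  using assms
proof (induction m rule: less_induct)
  case (less m)
  let ?M = "maximal_noncrossing (chords (W m))"
  let ?G = "\<lambda>i. {F \<in> maximal_noncrossing (chords (W i)). \<forall>j<i. d j \<notin> F}"
  \<comment> \<open>\<open>A i\<close> collects the families whose first chain chord is
    \<open>d i\<close>.\<close>
  define A where "A i = {F \<in> ?M. d i \<in> F \<and> (\<forall>j<i. d j \<notin> F)}" for i
  have fin: "finite ?M" using finite_maximal_noncrossing finite_chords less.prems(1) by blast
  have cA: "card (A i) = catalan i * catalan (m - i)" if i: "i < m" for i
  proof -
    obtain W' where h: "halves (W m) (d i) (W i) W'" using less.prems(4)[OF i] by blast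
    have "W i \<subseteq> W m" "W' \<subseteq> W m" using halves_Un[OF h] by blast+
    then have sub: "W i \<subseteq> W m" "finite (W i)" "finite W'"
      using less.prems(1) finite_subset by blast+
    \<comment> \<open>The halves share two vertices, so the other one has
      \<open>(m + 3) + 2 - (i + 3)\<close>.\<close>
    have cW': "card W' = m - i + 2"
      using card_halves[OF h less.prems(1)] less.prems(2)[of i] less.prems(2)[of m] i by simp
    have "\<exists>W''. halves (W i) (d j) (W j) W''" if j: "j < i" for j
    proof -
      obtain U where "halves (W m) (d j) (W j) U" using less.prems(4)[of j] i j by auto
      then show ?thesis 
        using halves_restrict[of "W m" "d j" "W j" U "W i"] less.prems(3)[of j i] sub(1) i j by auto
    qed
    then have IH: "card (?G i) = catalan i"
      using less.IH[OF i sub(2)] less.prems(2,3) i by (metis le_trans less_imp_le_nat)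
    \<comment> \<open>The earlier chords live in \<open>W i\<close>, so avoiding them restricts only
      the first component of the split along \<open>d i\<close>.\<close>
    have d_chord: "d j \<in> chords (W i)" if j: "j < i" for j
    proof -
      obtain U where "halves (W m) (d j) (W j) U" using less.prems(4)[of j] i j by auto
      then have "d j \<in> chords (W j)" by (rule chords_halves)
      then show ?thesis using chords_mono[of "W j" "W i"] less.prems(3)[of j i] i j by auto
    qed
    have "bij_betw (\<lambda>F. (F \<inter> chords (W i), F \<inter> chords W'))
        {F \<in> {F \<in> ?M. d i \<in> F}. \<forall>j<i. d j \<notin> F}
        {H \<in> maximal_noncrossing (chords (W i)) \<times> maximal_noncrossing (chords W'). \<forall>j<i. d j \<notin> fst H}"
      by (rule bij_betw_Collect[OF bij_betw_halves[OF h]]) (use d_chord in auto)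
    moreover have "{F \<in> {F \<in> ?M. d i \<in> F}. \<forall>j<i. d j \<notin> F} = A i"
      unfolding A_def by auto
    moreover have "{H \<in> maximal_noncrossing (chords (W i)) \<times> maximal_noncrossing (chords W').
        \<forall>j<i. d j \<notin> fst H} = ?G i \<times> maximal_noncrossing (chords W')"
      by auto
    ultimately have "card (A i) = card (?G i \<times> maximal_noncrossing (chords W'))"
      by (metis (no_types, lifting) bij_betw_same_card)
    then show ?thesis
      using IH card_maximal_noncrossing[OF sub(3) cW'] by (simp add: card_cartesian_product)
  qed
  have "?M = ?G m \<union> (\<Union>i<m. A i)"
  proof (intro equalityI subsetI)
    fix F assume F: "F \<in> ?M"
    show "F \<in> ?G m \<union> (\<Union>i<m. A i)"
    proof (cases "\<exists>i<m. d i \<in> F")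
      case True
      then obtain k where k: "k < m" "d k \<in> F" by blast
      then obtain i where i: "d i \<in> F" "\<forall>j<i. d j \<notin> F"
        using exists_least_iff[of "\<lambda>i. d i \<in> F"] by blast
      then have "i < m" using k by (metis le_less_trans not_le)
      with i show ?thesis using F unfolding A_def by auto
    qed (use F in auto)
  qed (auto simp: A_def)
  then have "card ?M = card (?G m \<union> (\<Union>i<m. A i))" by simp
  also have "\<dots> = card (?G m) + card (\<Union>i<m. A i)"
    by (rule card_Un_disjoint) (use fin in \<open>auto simp: A_def\<close>)
  also have "card (\<Union>i<m. A i) = (\<Sum>i<m. card (A i))"
  proof (rule card_UN_disjoint)
    have "A i \<inter> A j = {}" if "i < j" for i j using that unfolding A_def by auto
    then show "\<forall>i\<in>{..<m}. \<forall>j\<in>{..<m}. i \<noteq> j \<longrightarrow> A i \<inter> A j = {}"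
      by (metis Int_commute linorder_neqE_nat)
  qed (use fin in \<open>auto simp: A_def\<close>)
  also have "\<dots> = (\<Sum>i<m. catalan i * catalan (m - i))" using cA by simp
  finally have "card ?M = card (?G m) + (\<Sum>i<m. catalan i * catalan (m - i))" .
  moreover have "card ?M = catalan (Suc m)"
    by (rule card_maximal_noncrossing) (use less.prems in auto)
  \<comment> \<open>The terms with \<open>i < m\<close> match the sets \<open>A i\<close>. The term
    with \<open>i = m\<close> has the factor \<open>catalan 0 = 1\<close> and is what remains for
    the families avoiding the chain.\<close>
  moreover have "catalan (Suc m) = (\<Sum>i<m. catalan i * catalan (m - i)) + catalan m"
    unfolding catalan_Suc lessThan_Suc_atMost[symmetric] by (simp add: catalan_def)
  ultimately show ?case by simp
qed

section \<open>Sides and diagonals of the polygon\<close>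

text \<open>Without the modulus, only the closing side \<open>{0, n - 1}\<close> is
  exceptional.\<close>

lemma side_iff:
  assumes "3 \<le> n"
  shows "side n e \<longleftrightarrow> (\<exists>i. Suc i < n \<and> e = {i, Suc i}) \<or> e = {0, n - 1}"
proof
  assume "side n e"
  then obtain i where i: "i < n" "e = {i, (i + 1) mod n}" unfolding side_def by blast
  show "(\<exists>i. Suc i < n \<and> e = {i, Suc i}) \<or> e = {0, n - 1}"
  proof (cases "Suc i < n")
    case False
    then have "i = n - 1" "Suc i = n" using i by auto
    then have "e = {0, n - 1}" using i by auto
    then show ?thesis ..
  qed (use i in auto)
next
  assume "(\<exists>i. Suc i < n \<and> e = {i, Suc i}) \<or> e = {0, n - 1}"
  then show "side n e"
  proof
    assume "\<exists>i. Suc i < n \<and> e = {i, Suc i}"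
    then obtain i where "Suc i < n" "e = {i, Suc i}" by blast
    then show ?thesis unfolding side_def by (intro exI[of _ i]) auto
  next
    assume "e = {0, n - 1}"
    then show ?thesis using assms unfolding side_def by (intro exI[of _ "n - 1"]) auto
  qed
qed

lemma card_sides:
  assumes "3 \<le> n"
  shows "card {e. side n e} = n"
proof -
  have "{e. side n e} = insert {0, n - 1} ((\<lambda>i. {i, Suc i}) ` {..<n - 1})"
  proof -
    have "{..<n - 1} = {i. Suc i < n}" by auto
    then show ?thesis using side_iff[OF assms] by blast
  qed
  moreover have "{0, n - 1} \<notin> (\<lambda>i. {i, Suc i}) ` {..<n - 1}"
    using assms by (auto simp: doubleton_eq_iff)
  moreover have "inj_on (\<lambda>i. {i, Suc i}) {..<n - 1}"
    by (auto simp: inj_on_def doubleton_eq_iff)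
  ultimately show ?thesis using assms by (simp add: card_image)
qed

lemma side_in_chords: "3 \<le> n \<Longrightarrow> side n e \<Longrightarrow> e \<in> chords {..<n}"
  by (auto simp: side_iff doubleton_in_chords_iff)

lemma diagonal_iff: "3 \<le> n \<Longrightarrow> diagonal n e \<longleftrightarrow> e \<in> chords {..<n} \<and> \<not> side n e"
  unfolding diagonal_def chords_def by (simp, metis less_trans)

lemma diagonal_doubleton_iff:
  assumes "3 \<le> n" "a < b"
  shows "diagonal n {a, b} \<longleftrightarrow> b < n \<and> Suc a < b \<and> (0 < a \<or> b < n - 1)"
  using assms by (auto simp: diagonal_iff side_iff doubleton_in_chords_iff doubleton_eq_iff)

lemma side_not_crossing:
  assumes "3 \<le> n" "side n e" "f \<in> chords {..<n}"
  shows "\<not> crossing e f" "\<not> crossing f e"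
proof -
  obtain c d where "f = {c, d}" "c < d" "d < n" using assms(3) by (auto elim: chordsE)
  then show "\<not> crossing e f" using assms(1,2) by (auto simp: side_iff crossing_iff)
  then show "\<not> crossing f e" by (simp add: crossing_commute)
qed

text \<open>Sides cross no chord, so adding all of them turns maximality among diagonals into
  maximality among chords.\<close>

lemma triangulation_Un_sides:
  assumes "3 \<le> n" "triangulation n T"
  shows "T \<union> {e. side n e} \<in> maximal_noncrossing (chords {..<n})"
proof -
  have T: "e \<in> chords {..<n} \<and> \<not> side n e" if "e \<in> T" for e
    using assms that by (auto simp: triangulation_def noncrossing_def diagonal_iff)
  have nc: "\<not> crossing e f" if "e \<in> T" "f \<in> T" for e f
    using assms that by (auto simp: triangulation_def noncrossing_def)
  have "e \<in> T" if e: "e \<in> chords {..<n}" "\<not> side n e" "\<forall>f\<in>T. \<not> crossing e f" for e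
  proof (rule ccontr)
    assume "e \<notin> T"
    have "diagonal n e" using e assms by (simp add: diagonal_iff)
    then have "noncrossing n (insert e T)"
      using assms(2) e(3) not_crossing_self crossing_commute
      unfolding triangulation_def noncrossing_def by blast
    then show False using assms(2) \<open>diagonal n e\<close> \<open>e \<notin> T\<close> unfolding triangulation_def by blast
  qed
  then show ?thesis
    using T nc side_not_crossing[OF assms(1)] side_in_chords[OF assms(1)]
    unfolding maximal_noncrossing_def by blast
qed

lemma sides_in_maximal_noncrossing:
  assumes "3 \<le> n" "F \<in> maximal_noncrossing (chords {..<n})" "side n e"
  shows "e \<in> F"
  using maximal_noncrossing_iff[OF assms(2) side_in_chords[OF assms(1,3)]]
    side_not_crossing[OF assms(1,3)] maximal_noncrossing_subset[OF assms(2)] by blast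

lemma triangulation_Diff_sides:
  assumes "3 \<le> n" "F \<in> maximal_noncrossing (chords {..<n})"
  shows "triangulation n (F - {e. side n e})"
proof -
  have "noncrossing n (F - {e. side n e})"
    using maximal_noncrossing_not_crossing[OF assms(2)] maximal_noncrossing_subset[OF assms(2)] assms(1)
    unfolding noncrossing_def by (auto simp: diagonal_iff)
  moreover have "\<not> noncrossing n (insert e (F - {e. side n e}))"
    if "diagonal n e" "e \<notin> F - {e. side n e}" for e
  proof -
    have e: "e \<in> chords {..<n}" "\<not> side n e" using that assms by (auto simp: diagonal_iff)
    then obtain f where "f \<in> F" "crossing e f"
      using maximal_noncrossing_iff[OF assms(2) e(1)] \<open>e \<notin> F - {e. side n e}\<close> by blast
    then show ?thesis
      using side_not_crossing(2)[OF assms(1) _ e(1)] unfolding noncrossing_def by blast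
  qed
  ultimately show ?thesis unfolding triangulation_def by blast
qed

text \<open>Adding and removing the sides are mutually inverse. As \<open>T\<close> contains no
  side, neither operation affects whether a family meets \<open>T\<close>.\<close>

lemma card_disjoint_triangulations:
  assumes "3 \<le> n" "\<forall>e\<in>T. diagonal n e"
  shows "card {T'. triangulation n T' \<and> T' \<inter> T = {}}
       = card {F \<in> maximal_noncrossing (chords {..<n}). \<forall>e\<in>T. e \<notin> F}"
proof (rule bij_betw_same_card[where f = "\<lambda>T'. T' \<union> {e. side n e}"],
    rule bij_betw_byWitness[where f' = "\<lambda>F. F - {e. side n e}"])
  let ?S = "{e. side n e}"
  have no_side: "\<not> side n e" if "e \<in> T'" "triangulation n T'" for e T'
    using that unfolding triangulation_def noncrossing_def diagonal_def by blast
  show "\<forall>T'\<in>{T'. triangulation n T' \<and> T' \<inter> T = {}}. (T' \<union> ?S) - ?S = T'"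
    using no_side by blast
  show "\<forall>F\<in>{F \<in> maximal_noncrossing (chords {..<n}). \<forall>e\<in>T. e \<notin> F}. (F - ?S) \<union> ?S = F"
    using sides_in_maximal_noncrossing[OF assms(1)] by blast
  show "(\<lambda>T'. T' \<union> ?S) ` {T'. triangulation n T' \<and> T' \<inter> T = {}}
      \<subseteq> {F \<in> maximal_noncrossing (chords {..<n}). \<forall>e\<in>T. e \<notin> F}"
    using triangulation_Un_sides[OF assms(1)] assms(2) unfolding diagonal_def by blast
  show "(\<lambda>F. F - ?S) ` {F \<in> maximal_noncrossing (chords {..<n}). \<forall>e\<in>T. e \<notin> F}
      \<subseteq> {T'. triangulation n T' \<and> T' \<inter> T = {}}"
    using triangulation_Diff_sides[OF assms(1)] by blast
qed

section \<open>Ears\<close>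

text \<open>Descent: unless the chord already has length two, the apex inside its interval yields a
  strictly shorter chord still of length at least two. A chord \<open>{i, i + 2}\<close> cuts off an
  ear with tip \<open>i + 1\<close>.\<close>

lemma short_chord_in_interval:
  assumes "F \<in> maximal_noncrossing (chords {..<n})" "{a, b} \<in> F" "a + 2 \<le> b"
  shows "\<exists>i\<ge>a. i + 2 \<le> b \<and> {i, i + 2} \<in> F"
  using assms(2,3)
proof (induction "b - a" arbitrary: a b rule: less_induct)
  case less
  show ?case
  proof (cases "b = a + 2")
    case True
    then show ?thesis using less.prems by auto
  next
    case False
    have "a < b" using less.prems by simp
    then have "{a, b} \<in> chords {..<n} \<longleftrightarrow> b < n" by (auto simp: doubleton_in_chords_iff)
    then have "b < n" using maximal_noncrossing_subset[OF assms(1)] less.prems(1) by blast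
    then have "Suc a \<in> {..<n} \<inter> {a<..<b}" using less.prems by simp
    then have "{..<n} \<inter> {a<..<b} \<noteq> {}" by blast
    then obtain v where v: "a < v" "v < b" "{a, v} \<in> F" "{v, b} \<in> F"
      using apex_exists[OF _ assms(1) less.prems(1) \<open>a < b\<close>] by blast
    show ?thesis
    proof (cases "a + 2 \<le> v")
      case True
      moreover have "v - a < b - a" using v by simp
      ultimately obtain i where "i \<ge> a" "i + 2 \<le> v" "{i, i + 2} \<in> F"
        using less.hyps v(3) by blast
      moreover from this have "i + 2 \<le> b" using v(2) by simp
      ultimately show ?thesis by blast
    next
      case v_le: False
      \<comment> \<open>Here \<open>v = a + 1\<close>, and \<open>b\<close> is at least
        \<open>a + 3\<close> because length two has been settled.\<close>
      then have "v + 2 \<le> b" using v(1,2) less.prems(2) False by simp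
      moreover have "b - v < b - a" using v by simp
      ultimately obtain i where "i \<ge> v" "i + 2 \<le> b" "{i, i + 2} \<in> F"
        using less.hyps v(4) by blast
      moreover from this have "i \<ge> a" using v(1) by simp
      ultimately show ?thesis by blast
    qed
  qed
qed

lemma earI:
  assumes "i < j" "j < k" "k < n"
    and "{i, j} \<in> T \<union> {e. side n e}" "{j, k} \<in> T \<union> {e. side n e}" "{i, k} \<in> T \<union> {e. side n e}"
    and "e \<noteq> f" "side n e" "side n f" "e \<in> {{i, j}, {j, k}, {i, k}}" "f \<in> {{i, j}, {j, k}, {i, k}}"
  shows "{i, j, k} \<in> ears n T"
proof -
  have "{i, j, k} \<in> triangles n T"
    unfolding triangles_def using assms(1-6) by blast
  moreover have "{e, f} \<subseteq> {e. e \<subseteq> {i, j, k} \<and> card e = 2 \<and> side n e}"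
    using assms(1,2,8-11) by auto
  then have "card {e, f} \<le> card {e. e \<subseteq> {i, j, k} \<and> card e = 2 \<and> side n e}"
    by (intro card_mono) auto
  ultimately show ?thesis
    unfolding ears_def using \<open>e \<noteq> f\<close> by simp
qed

lemma side_SucI: "3 \<le> n \<Longrightarrow> Suc i < n \<Longrightarrow> side n {i, Suc i}"
  by (subst side_iff) auto

lemma ear_in_interval:
  assumes "3 \<le> n" "triangulation n T" "{a, b} \<in> T \<union> {e. side n e}" "a + 2 \<le> b" "b < n"
  shows "\<exists>t\<in>ears n T. t \<subseteq> {a..b}"
proof -
  obtain i where i: "i \<ge> a" "i + 2 \<le> b" "{i, i + 2} \<in> T \<union> {e. side n e}"
    using short_chord_in_interval[OF triangulation_Un_sides[OF assms(1,2)] assms(3,4)] by blast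
  have sides: "side n {i, Suc i}" "side n {Suc i, Suc (Suc i)}"
    using i assms by (auto intro!: side_SucI)
  have "{i, Suc i} \<noteq> {Suc i, Suc (Suc i)}" by (simp add: doubleton_eq_iff)
  then have "{i, Suc i, Suc (Suc i)} \<in> ears n T"
    using earI[of i "Suc i" "Suc (Suc i)" n T "{i, Suc i}" "{Suc i, Suc (Suc i)}"] i sides \<open>b < n\<close>
    by simp
  moreover have "{i, Suc i, Suc (Suc i)} \<subseteq> {a..b}" using i by auto
  ultimately show ?thesis by blast
qed

text \<open>The apex of the triangle on the side \<open>{0, n - 1}\<close> lies in \<open>{0..a}\<close> or in \<open>{b..n - 1}\<close>,
  and cuts off an interval there, unless it is next to \<open>0\<close> or \<open>n - 1\<close>, in which case that triangle is an ear.\<close>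

lemma ear_outside_interval:
  assumes "4 \<le> n" "triangulation n T" "{a, b} \<in> T" "a < b"
  shows "\<exists>t\<in>ears n T. t \<subseteq> {..<n} - {a<..<b}"
proof -
  let ?F = "T \<union> {e. side n e}"
  have n3: "3 \<le> n" using assms by simp
  have F: "?F \<in> maximal_noncrossing (chords {..<n})"
    using triangulation_Un_sides[OF n3 assms(2)] .
  have ab: "b < n" "Suc a < b" "0 < a \<or> b < n - 1"
    using assms n3 by (auto simp: triangulation_def noncrossing_def diagonal_doubleton_iff)
  have base: "{0, n - 1} \<in> ?F" "side n {0, n - 1}" using n3 by (auto simp: side_iff)
  have "1 \<in> {..<n} \<inter> {0<..<n - 1}" using assms by simp
  then have "{..<n} \<inter> {0<..<n - 1} \<noteq> {}" by blast
  then obtain v where v: "0 < v" "v < n - 1" "{0, v} \<in> ?F" "{v, n - 1} \<in> ?F"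
    using apex_exists[OF _ F base(1)] assms(1) by auto
  \<comment> \<open>An apex strictly between \<open>a\<close> and \<open>b\<close> would give a
    crossing with \<open>{0, v}\<close> if \<open>0 < a\<close>, and with \<open>{v, n - 1}\<close>
    if \<open>b < n - 1\<close>. One of these holds since \<open>{a, b}\<close> is a
    diagonal.\<close>
  have "\<not> crossing {a, b} {0, v}" "\<not> crossing {a, b} {v, n - 1}"
    using maximal_noncrossing_not_crossing[OF F] assms(3) v by blast+
  then have "v \<le> a \<or> b \<le> v"
    using assms(4) v ab by (auto simp: crossing_iff)
  then show ?thesis
  proof
    assume va: "v \<le> a"
    show ?thesis
    proof (cases "v = 1")
      case True
      have "{0, 1, n - 1} \<in> ears n T"
      proof -
        have "{0, 1} \<noteq> {0, n - 1}" using assms(1) by (simp add: doubleton_eq_iff)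
        moreover have "side n {0, 1}" using side_SucI[of n 0] n3 by simp
        ultimately show ?thesis
          using earI[of 0 1 "n - 1" n T "{0, 1}" "{0, n - 1}"] base v(4) True assms(1) by simp
      qed
      moreover have "{0, 1, n - 1} \<subseteq> {..<n} - {a<..<b}" using va True ab by auto
      ultimately show ?thesis by blast
    next
      case False
      then have "0 + 2 \<le> v" "v < n" using v(1,2) by simp_all
      then obtain t where "t \<in> ears n T" "t \<subseteq> {0..v}"
        using ear_in_interval[OF n3 assms(2) v(3)] by blast
      moreover have "{0..v} \<subseteq> {..<n} - {a<..<b}" using va v by auto
      ultimately show ?thesis by blast
    qed
  next
    assume vb: "b \<le> v"
    show ?thesis
    proof (cases "v = n - 2")
      case True
      have *: "Suc (n - 2) = n - 1" using assms(1) by simp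
      have "{0, n - 2, n - 1} \<in> ears n T"
      proof -
        have lt: "0 < n - 2" "n - 2 < n - 1" "n - 1 < n" using assms(1) by simp_all
        have ne: "{n - 2, n - 1} \<noteq> {0, n - 1}" using assms(1) by (simp add: doubleton_eq_iff)
        have side: "side n {n - 2, n - 1}" using side_SucI[of n "n - 2"] n3 * by simp
        show ?thesis
          by (rule earI[OF lt v(3,4)[unfolded True] base(1) ne side base(2)]) simp_all
      qed
      moreover have "{0, n - 2, n - 1} \<subseteq> {..<n} - {a<..<b}" using vb True ab by auto
      ultimately show ?thesis by blast
    next
      case False
      then have "v + 2 \<le> n - 1" "n - 1 < n" using v(2) assms(1) by linarith+
      then obtain t where "t \<in> ears n T" "t \<subseteq> {v..n - 1}"
        using ear_in_interval[OF n3 assms(2) v(4)] by blast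
      moreover have "{v..n - 1} \<subseteq> {..<n} - {a<..<b}" using vb v by auto
      ultimately show ?thesis by blast
    qed
  qed
qed

text \<open>With only two ears available, this will place one of them on each side of every
  diagonal.\<close>

lemma ear_in_half:
  assumes "4 \<le> n" "triangulation n T" "d \<in> T" "halves {..<n} d W W'"
  shows "\<exists>t\<in>ears n T. t \<subseteq> W"
proof -
  obtain a b where ab: "a < b" "d = {a, b}" "b < n" "W = {..<n} \<inter> {a..b} \<or> W = {..<n} - {a<..<b}"
    using assms(4) unfolding halves_def by auto
  have "diagonal n {a, b}" using assms ab by (auto simp: triangulation_def noncrossing_def)
  then have "a + 2 \<le> b" using assms(1) ab(1) by (simp add: diagonal_doubleton_iff)
  then obtain t where "t \<in> ears n T" "t \<subseteq> {a..b}"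
    using ear_in_interval[of n T a b] assms ab by auto
  moreover have "{a..b} \<subseteq> {..<n}" using ab by auto
  ultimately show ?thesis
    using ab(4) ear_outside_interval[of n T a b] assms ab by blast
qed

text \<open>Otherwise some edge of the triangle would join vertices strictly on opposite sides of
  \<open>d\<close> and cross it.\<close>

lemma triangle_in_half:
  assumes "3 \<le> n" "triangulation n T" "d \<in> T" "halves {..<n} d W W'" "t \<in> triangles n T"
  shows "t \<subseteq> W \<or> t \<subseteq> W'"
proof (rule ccontr)
  assume *: "\<not> (t \<subseteq> W \<or> t \<subseteq> W')"
  obtain i j k where t: "i < j" "j < k" "k < n" "t = {i, j, k}"
    and e: "\<forall>e\<in>{{i, j}, {j, k}, {i, k}}. side n e \<or> e \<in> T"
    using assms(5) unfolding triangles_def by blast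
  obtain x y where xy: "x \<in> t" "x \<notin> W" "y \<in> t" "y \<notin> W'" using * by blast
  have "t \<subseteq> {..<n}" using t by auto
  then have "x \<noteq> y" "{x, y} \<subseteq> {..<n}" using xy halves_Un[OF assms(4)] by blast+
  then have "{x, y} \<in> {{i, j}, {j, k}, {i, k}}" using xy t(4) by (auto simp: insert_commute)
  then have F: "{x, y} \<in> T \<union> {e. side n e}" using e by blast
  note M = triangulation_Un_sides[OF assms(1,2)]
  have "{x, y} \<in> chords {..<n}" using maximal_noncrossing_subset[OF M] F by blast
  moreover have "\<not> crossing {x, y} d"
    using maximal_noncrossing_not_crossing[OF M F] assms(3) by blast
  ultimately have "{x, y} \<in> chords W \<union> chords W'"
    using chords_halves(1)[OF assms(4)] by blast
  then show False using chords_subset xy by blast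
qed

lemma card_ear: "t \<in> ears n T \<Longrightarrow> card t = 3"
  unfolding ears_def triangles_def by auto

text \<open>The half inside the interval of a diagonal misses \<open>0\<close> or
  \<open>n - 1\<close>, while the other half contains both. Hence a half reveals its kind, and then
  its endpoints.\<close>

lemma halves_inject:
  assumes "4 \<le> n" "diagonal n d" "diagonal n e" "halves {..<n} d W W'" "halves {..<n} e W U'"
  shows "d = e"
proof -
  obtain a b where ab: "a < b" "d = {a, b}" "b < n"
    and W: "W = {..<n} \<inter> {a..b} \<or> W = {..<n} - {a<..<b}"
    using assms(4) unfolding halves_def by auto
  obtain c f where cf: "c < f" "e = {c, f}" "f < n"
    and U: "W = {..<n} \<inter> {c..f} \<or> W = {..<n} - {c<..<f}"
    using assms(5) unfolding halves_def by auto
  have ab': "Suc a < b" "0 < a \<or> b < n - 1" and cf': "Suc c < f" "0 < c \<or> f < n - 1"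
    using assms(1-3) ab cf by (auto simp: diagonal_doubleton_iff)
  have I: "{..<n} \<inter> {a..b} = {a..b}" "{..<n} \<inter> {c..f} = {c..f}" using ab cf by auto
  have O: "{0, n - 1} \<subseteq> {..<n} - {a<..<b}" "{0, n - 1} \<subseteq> {..<n} - {c<..<f}"
    using ab cf by auto
  have nI: "\<not> {0, n - 1} \<subseteq> {a..b}" "\<not> {0, n - 1} \<subseteq> {c..f}" using ab cf ab' cf' by auto
  consider "{a..b} = {c..f}" | "{..<n} - {a<..<b} = {..<n} - {c<..<f}"
    using W U I O nI by metis
  then have "a = c \<and> b = f"
  proof cases
    case 1
    then show ?thesis using ab(1) cf(1) by (simp add: Icc_eq_Icc)
  next
    case 2
    have "{a<..<b} \<subseteq> {..<n}" "{c<..<f} \<subseteq> {..<n}" using ab(3) cf(3) by auto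
    then have "{a<..<b} = {c<..<f}" using 2 by blast
    \<comment> \<open>Both open intervals are nonempty because the chords are diagonals, so their
      closed forms determine the endpoints.\<close>
    moreover have "{a<..<b} = {Suc a..b - 1}" "{c<..<f} = {Suc c..f - 1}" by auto
    ultimately have "{Suc a..b - 1} = {Suc c..f - 1}" by simp
    then show ?thesis using ab'(1) cf'(1) by (auto simp: Icc_eq_Icc)
  qed
  then show ?thesis using ab cf by simp
qed

section \<open>Ordering the diagonals of a two-eared triangulation\<close>

theorem theorem3p1:
  fixes n :: nat and T :: "nat set set"
  assumes "n \<ge> 4" and "triangulation n T" and "two_eared n T"
  shows "card {T'. triangulation n T' \<and> T' \<inter> T = {}} = catalan (n - 3)"
proof -
  let ?V = "{..<n}"
  have n3: "3 \<le> n" using assms(1) by simp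
  have diag: "diagonal n d" if "d \<in> T" for d
    using assms(2) that by (auto simp: triangulation_def noncrossing_def)
  note M = triangulation_Un_sides[OF n3 assms(2)]
  obtain E1 E2 where E: "ears n T = {E1, E2}" "E1 \<noteq> E2"
    using assms(3) unfolding two_eared_def card_2_iff by blast
  have cE: "card E1 = 3" "card E2 = 3" using card_ear[of _ n T] unfolding E(1) by simp_all
  \<comment> \<open>An ear has three vertices, but the two halves share only the two ends of
    \<open>d\<close>.\<close>
  have not_both: False if "halves ?V d U U'" "t \<subseteq> U" "t \<subseteq> U'" "card t = 3" for d U U' t
  proof -
    have "card d = 2" using that(1) unfolding halves_def by auto
    moreover have "t \<subseteq> d" using that(2,3) halves_Int[OF that(1)] by blast
    ultimately show False
      using that(4) card_mono[of d t] by (simp add: card_ge_0_finite)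
  qed
  have "\<exists>U U'. halves ?V d U U' \<and> E1 \<subseteq> U \<and> E2 \<subseteq> U'" if d: "d \<in> T" for d
  proof -
    obtain a b where "a < b" "b < n" "d = {a, b}"
      using diag[OF d] unfolding diagonal_def by blast
    then have "halves ?V d (?V \<inter> {a..b}) (?V - {a<..<b})" 
      unfolding halves_def by (intro exI[of _ a] exI[of _ b]) simp
    moreover have "E1 \<in> ears n T" unfolding E(1) by simp
    then have "E1 \<in> triangles n T" unfolding ears_def by simp
    ultimately obtain U U' where h: "halves ?V d U U'" "E1 \<subseteq> U"
      using triangle_in_half[OF n3 assms(2) d] halves_commute by metis
    \<comment> \<open>The half opposite to \<open>E1\<close> contains some ear, which cannot be
      \<open>E1\<close> again.\<close>
    obtain t where "t \<in> ears n T" "t \<subseteq> U'"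
      using ear_in_half[OF assms(1,2) d] h(1) halves_commute by blast
    then have "E2 \<subseteq> U'" using not_both[OF h] cE(1) unfolding E(1) by auto
    then show ?thesis using h by blast
  qed
  then obtain W W' where W: "halves ?V d (W d) (W' d)" "E1 \<subseteq> W d" "E2 \<subseteq> W' d" if "d \<in> T" for d
    by metis
  have fin: "finite (W d)" "finite (W' d)" if "d \<in> T" for d
    using halves_Un[OF W(1)[OF that]] by (metis finite_Un finite_lessThan)+
  have nested: "W d \<subseteq> W e \<or> W e \<subseteq> W d" if d: "d \<in> T" and e: "e \<in> T" for d e
  proof -
    have "\<not> crossing d e" using maximal_noncrossing_not_crossing[OF M] d e by blast
    then consider "W d \<subseteq> W e" | "W e \<subseteq> W d" | "W d \<subseteq> W' e" | "W' e \<subseteq> W d"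
      using halves_nested[OF W(1)[OF d] W(1)[OF e]] by blast
    then show ?thesis
    \<comment> \<open>\<open>W d \<subseteq> W' e\<close> would put \<open>E1\<close> in both halves
      of \<open>e\<close>, and \<open>W' e \<subseteq> W d\<close> would put \<open>E2\<close> in
      both halves of \<open>d\<close>.\<close>
    proof cases
      case 3
      then show ?thesis using not_both[OF W(1)[OF e] W(2)[OF e]] W(2)[OF d] cE(1) by blast
    next
      case 4
      then show ?thesis using not_both[OF W(1)[OF d] _ W(3)[OF d]] W(3)[OF e] cE(2) by blast
    qed auto
  qed
  have W_mono: "W d \<subseteq> W e" if "d \<in> T" "e \<in> T" "card (W d) \<le> card (W e)" for d e
    using nested[OF that(1,2)] card_seteq[OF fin(1)[OF that(1)] _ that(3)] by blast
  \<comment> \<open>\<open>k d\<close> is the position of \<open>d\<close> in the chain. The shift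
    by three makes a half consisting of just the ear \<open>E1\<close> the first one.\<close>
  define k where "k d = card (W d) - 3" for d
  \<comment> \<open>Each half contains an ear, and the sizes add up to \<open>n + 2\<close>, so
    \<open>card (W d)\<close> lies between \<open>3\<close> and \<open>n - 1\<close>.\<close>
  have card_W: "card (W d) = k d + 3" "k d < n - 3" if d: "d \<in> T" for d
  proof -
    have "3 \<le> card (W d)" "3 \<le> card (W' d)"
      using card_mono[OF fin(1)[OF d] W(2)[OF d]] card_mono[OF fin(2)[OF d] W(3)[OF d]] cE by auto
    moreover have "card (W d) + card (W' d) = n + 2"
      using card_halves[OF W(1)[OF d]] by simp
    ultimately show "card (W d) = k d + 3" "k d < n - 3" unfolding k_def by auto
  qed
  have inj: "inj_on k T"
  proof (rule inj_onI)
    fix d e assume d: "d \<in> T" and e: "e \<in> T" and "k d = k e"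
    then have "W d = W e" using card_W W_mono by (metis order_refl subset_antisym)
    then show "d = e"
      using halves_inject[OF assms(1) diag[OF d] diag[OF e] W(1)[OF d]] W(1)[OF e] by simp
  qed
  \<comment> \<open>The maximal family has \<open>2 * n - 3\<close> chords, of which
    \<open>n\<close> are sides. Hence the positions, being distinct, exhaust all values below
    \<open>n - 3\<close>.\<close>
  have "card T = n - 3"
  proof -
    have "T \<inter> {e. side n e} = {}" using diag unfolding diagonal_def by blast
    moreover have "finite (T \<union> {e. side n e})"
      using maximal_noncrossing_subset[OF M] finite_chords finite_subset by blast
    ultimately have "card (T \<union> {e. side n e}) = card T + n"
      using card_Un_disjoint[of T "{e. side n e}"] card_sides[OF n3] by simp
    then show ?thesis
      using card_in_maximal_noncrossing[OF _ _ M] assms(1) by simp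
  qed
  moreover have "k ` T \<subseteq> {..<n - 3}" using card_W(2) by blast
  ultimately have "k ` T = {..<n - 3}"
    using card_image[OF inj] by (intro card_subset_eq) auto
  with inj have bij: "bij_betw k T {..<n - 3}" unfolding bij_betw_def by blast
  define D where "D = the_inv_into T k"
  have D: "D i \<in> T" "k (D i) = i" if "i < n - 3" for i
    using bij that unfolding D_def bij_betw_def
    by (auto intro: the_inv_into_into f_the_inv_into_f)
  \<comment> \<open>The default value closes the chain with the whole polygon, whose
    \<open>n\<close> vertices fit the pattern \<open>i + 3\<close> at
    \<open>i = n - 3\<close>.\<close>
  define X where "X i = (if i < n - 3 then W (D i) else ?V)" for i
  have X_top: "X (n - 3) = ?V" unfolding X_def by simp
  have "card {F \<in> maximal_noncrossing (chords (X (n - 3))). \<forall>i<n - 3. D i \<notin> F} = catalan (n - 3)"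
  proof (rule card_avoiding_chain)
    show "finite (X (n - 3))" unfolding X_top by simp
    show "card (X i) = i + 3" if "i \<le> n - 3" for i
      using that card_W(1)[OF D(1)] D(2) n3 unfolding X_def by auto
    show "X i \<subseteq> X j" if "i \<le> j" "j \<le> n - 3" for i j
    proof (cases "j < n - 3")
      case True
      then have "i < n - 3" using that by simp
      then show ?thesis
        using True W_mono[OF D(1) D(1)] card_W(1)[OF D(1)] D(2) that(1) unfolding X_def by simp
    next
      case False
      then show ?thesis
        using halves_Un[OF W(1)[OF D(1)]] unfolding X_def by auto
    qed
    show "\<exists>U'. halves (X (n - 3)) (D i) (X i) U'" if "i < n - 3" for i
      using W(1)[OF D(1)[OF that]] that unfolding X_top unfolding X_def by auto
  qed
  moreover have "(\<forall>i<n - 3. D i \<notin> F) \<longleftrightarrow> (\<forall>e\<in>T. e \<notin> F)" for F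
  proof -
    have "D ` {..<n - 3} = T"
      using bij unfolding D_def by (metis bij_betw_def bij_betw_the_inv_into)
    then show ?thesis by blast
  qed
  ultimately show ?thesis
    using card_disjoint_triangulations[OF n3] diag X_top by simp
qed

end
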